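(* Let $d \ge 1$ be an integer, and let $f \colon \mathbb{C}^2 \to \mathbb{C}^2$ be a $d$-linear map, i.e. there are $t, a_{i,j} \in \mathbb{C}$ ($1 \le i,j \le 2$), $t \neq 0$, such that \[ f_i(x_1,x_2) = x_i - \bigl(t(a_{i,1}x_1 + a_{i,2}x_2)\bigr)^d, \qquad i = 1,2. \] Suppose that $\mathrm{Jac}(f)(x) = 1$ for all $x \in \mathbb{C}^2$. Then the formal inverse $g(x)$ of $f(x)$ is a polynomial map.
   Context: A polynomial map $\mathbb{C}^n \to \mathbb{C}^n$ is a map $(x_1,\dots,x_n) \mapsto (f_1(x_1,\dots,x_n),\dots,f_n(x_1,\dots,x_n))$ in which each component $f_i$ is a polynomial. $\mathrm{Jac}(f)(x) = \det(D(f)(x))$, where $D(f)(x) = (\partial f_i/\partial x_j)_{i,j}$ is the differential of $f$ at $x$. The formal inverse $g = (g_1,g_2)$ of $f$ is the pair of formal power series in $x = (x_1,x_2)$ with zero constant terms which is the inverse of $f$ under composition of formal power series: $f(g(x)) = x = g(f(x))$. To say $g$ is a polynomial map means that $g_1$ and $g_2$ are polynomials in $x_1,x_2$. For $d=1$ the exponent $d$ is $1$, so $f$ is linear. *)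

theory Defs
  imports "HOL-Analysis.Analysis" "HOL-Computational_Algebra.Polynomial_FPS"
begin

(* Bivariate polynomials are elements of C[x_1][x_2], i.e. of type complex poly poly, and
   bivariate formal power series are elements of C[[x_1]][[x_2]], i.e. of type complex fps fps.
   In both cases x_2 is the outer variable. *)

definition poly2 :: "complex poly poly \<Rightarrow> complex ^ 2 \<Rightarrow> complex" where
  "poly2 p x = poly (poly p [:x $ 2:]) (x $ 1)"

definition poly_map :: "complex poly poly ^ 2 \<Rightarrow> complex ^ 2 \<Rightarrow> complex ^ 2" where
  "poly_map p x = (\<chi> i. poly2 (p $ i) x)"

definition d_linear_map :: "nat \<Rightarrow> (complex ^ 2 \<Rightarrow> complex ^ 2) \<Rightarrow> bool" where
  "d_linear_map d f \<longleftrightarrow>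
     (\<exists>(t :: complex) (a :: complex ^ 2 ^ 2). t \<noteq> 0 \<and>
        (\<forall>x i. f x $ i = x $ i - (t * (a $ i $ 1 * x $ 1 + a $ i $ 2 * x $ 2)) ^ d))"

definition partial_deriv :: "(complex ^ 'n \<Rightarrow> complex) \<Rightarrow> 'n::finite \<Rightarrow> complex ^ 'n \<Rightarrow> complex" where
  "partial_deriv h j x = deriv (\<lambda>z. h (\<chi> k. if k = j then z else x $ k)) (x $ j)"

definition Jac :: "(complex ^ 'n \<Rightarrow> complex ^ 'n::finite) \<Rightarrow> complex ^ 'n \<Rightarrow> complex" where
  "Jac f x = det (\<chi> i j. partial_deriv (\<lambda>y. f y $ i) j x)"

(* The coefficient of x_1^m x_2^n. *)
definition coeff2 :: "complex fps fps \<Rightarrow> nat \<Rightarrow> nat \<Rightarrow> complex" where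
  "coeff2 F m n = fps_nth (fps_nth F n) m"

definition fps2_of_poly :: "complex poly poly \<Rightarrow> complex fps fps" where
  "fps2_of_poly p = fps_of_poly (map_poly fps_of_poly p)"

definition fps2_vars :: "complex fps fps ^ 2" where
  "fps2_vars = vector [fps_const fps_X, fps_X]"

definition zero_const :: "complex fps fps ^ 2 \<Rightarrow> bool" where
  "zero_const u \<longleftrightarrow> (\<forall>i. coeff2 (u $ i) 0 0 = 0)"

(* Substitution h(u_1, u_2) = sum_{i,j} h_{ij} u_1^i u_2^j, meaningful when u_1 and u_2 have zero
   constant term: then u_1^i u_2^j contributes to the coefficient of x_1^m x_2^n only if
   i + j <= m + n (see coeff2_monomial_eq_0 below), so the coefficient is the finite sum given. *)
definition fps2_compose :: "complex fps fps \<Rightarrow> complex fps fps ^ 2 \<Rightarrow> complex fps fps" where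
  "fps2_compose h u = Abs_fps (\<lambda>n. Abs_fps (\<lambda>m.
     \<Sum>(i, j) | i + j \<le> m + n. coeff2 h i j * coeff2 ((u $ 1) ^ i * (u $ 2) ^ j) m n))"

lemma coeff2_mult_eq_0:
  assumes "\<And>m n. m + n < k \<Longrightarrow> coeff2 F m n = 0"
    and "\<And>m n. m + n < l \<Longrightarrow> coeff2 G m n = 0"
    and "m + n < k + l"
  shows "coeff2 (F * G) m n = 0"
proof -
  have "coeff2 F a b * coeff2 G (m - a) (n - b) = 0" if "a \<le> m" "b \<le> n" for a b
    using assms(1)[of a b] assms(2)[of "m - a" "n - b"] assms(3) that
    by (cases "a + b < k") auto
  then show ?thesis
    unfolding coeff2_def by (auto simp: fps_mult_nth fps_sum_nth intro!: sum.neutral)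
qed

lemma coeff2_power_eq_0:
  assumes "coeff2 F 0 0 = 0" and "m + n < k"
  shows "coeff2 (F ^ k) m n = 0"
  using assms(2)
proof (induction k arbitrary: m n)
  case (Suc k)
  have "coeff2 F a b = 0" if "a + b < 1" for a b
    using assms(1) that by simp
  then have "coeff2 (F * F ^ k) m n = 0"
    using Suc by (intro coeff2_mult_eq_0[where k = 1 and l = k]) auto
  then show ?case by simp
qed simp

lemma coeff2_monomial_eq_0:
  assumes "zero_const u" and "m + n < i + j"
  shows "coeff2 ((u $ 1) ^ i * (u $ 2) ^ j) m n = 0"
  using assms unfolding zero_const_def
  by (intro coeff2_mult_eq_0[where k = i and l = j] coeff2_power_eq_0) auto

definition fps2_compose_map ::
    "complex fps fps ^ 2 \<Rightarrow> complex fps fps ^ 2 \<Rightarrow> complex fps fps ^ 2" where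
  "fps2_compose_map h u = (\<chi> i. fps2_compose (h $ i) u)"

(* p is the tuple of polynomials defining f; it is determined by f since C is infinite. *)
definition formal_inverse :: "(complex ^ 2 \<Rightarrow> complex ^ 2) \<Rightarrow> complex fps fps ^ 2 \<Rightarrow> bool" where
  "formal_inverse f g \<longleftrightarrow>
     (\<exists>p F. f = poly_map p \<and> F = (\<chi> i. fps2_of_poly (p $ i)) \<and>
        zero_const F \<and> zero_const g \<and>
        fps2_compose_map F g = fps2_vars \<and> fps2_compose_map g F = fps2_vars)"

definition is_poly_map :: "complex fps fps ^ 2 \<Rightarrow> bool" where
  "is_poly_map g \<longleftrightarrow> (\<forall>i. \<exists>q. g $ i = fps2_of_poly q)"

end

(* For d = 1 the map is linear with determinant 1. For d \<ge> 2, write the linear forms, scaled by t, as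
   the rows of a matrix A. Comparing homogeneous parts in Jac f = 1 forces det A = 0 and
   A_11 l_1^(d-1) + A_22 l_2^(d-1) = 0, so both l_i are multiples c_i l of one form l, and
   f = x - w l(x)^d with w_i = c_i^d and l(w) = 0. Hence l is invariant under f, and
   x + w l(x)^d is the inverse. *)

theory Submission
  imports Defs
begin

subsection \<open>Evaluating bivariate polynomials at power series\<close>

lemma map_poly_add_hom:
  fixes h :: "'a::comm_semiring_0 \<Rightarrow> 'b::comm_semiring_0"
  assumes "h 0 = 0" "\<And>a b. h (a + b) = h a + h b"
  shows "map_poly h (p + q) = map_poly h p + map_poly h q"
  by (rule poly_eqI) (simp add: coeff_map_poly assms)

lemma map_poly_mult_hom:
  fixes h :: "'a::comm_semiring_0 \<Rightarrow> 'b::comm_semiring_0"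
  assumes "h 0 = 0" "\<And>a b. h (a + b) = h a + h b" "\<And>a b. h (a * b) = h a * h b"
  shows "map_poly h (p * q) = map_poly h p * map_poly h q"
proof -
  have "h (sum s S) = (\<Sum>i\<in>S. h (s i))" for s :: "nat \<Rightarrow> 'a" and S
    by (induction S rule: infinite_finite_induct) (simp_all add: assms)
  then show ?thesis
    by (intro poly_eqI) (simp add: coeff_map_poly coeff_mult assms)
qed

text \<open>Evaluation inside the ring \<open>complex fps fps\<close> is a ring homomorphism at
  every argument, with no condition on constant terms, so polynomial identities carry over
  directly.\<close>

definition eval1 :: "complex fps fps \<Rightarrow> complex poly \<Rightarrow> complex fps fps" where
  "eval1 v a = poly (map_poly (\<lambda>c. fps_const (fps_const c)) a) v"

definition eval2 :: "complex fps fps ^ 2 \<Rightarrow> complex poly poly \<Rightarrow> complex fps fps" where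
  "eval2 u P = poly (map_poly (eval1 (u $ 1)) P) (u $ 2)"

lemma eval1_0 [simp]: "eval1 v 0 = 0"
  by (simp add: eval1_def)

lemma eval1_add: "eval1 v (a + b) = eval1 v a + eval1 v b"
  by (simp add: eval1_def map_poly_add_hom)

lemma eval1_mult: "eval1 v (a * b) = eval1 v a * eval1 v b"
  by (simp add: eval1_def map_poly_mult_hom)

lemma eval1_pCons: "eval1 v (pCons c a) = fps_const (fps_const c) + v * eval1 v a"
  by (simp add: eval1_def map_poly_pCons)

lemma eval2_0 [simp]: "eval2 u 0 = 0"
  by (simp add: eval2_def)

lemma eval2_add [simp]: "eval2 u (P + Q) = eval2 u P + eval2 u Q"
  by (simp add: eval2_def map_poly_add_hom eval1_add)

lemma eval2_mult [simp]: "eval2 u (P * Q) = eval2 u P * eval2 u Q"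
  by (simp add: eval2_def map_poly_mult_hom eval1_add eval1_mult)

lemma eval2_pCons: "eval2 u (pCons a P) = eval1 (u $ 1) a + u $ 2 * eval2 u P"
  by (simp add: eval2_def map_poly_pCons)

lemma eval2_diff [simp]: "eval2 u (P - Q) = eval2 u P - eval2 u Q"
proof -
  have "eval2 u P = eval2 u (P - Q) + eval2 u Q"
    by (simp flip: eval2_add)
  then show ?thesis by simp
qed

lemma eval2_const [simp]: "eval2 u [:[:c:]:] = fps_const (fps_const c)"
  by (simp add: eval2_pCons eval1_pCons)

lemma eval2_smult [simp]: "eval2 u (smult [:c:] P) = fps_const (fps_const c) * eval2 u P"
  using eval2_mult[of u "[:[:c:]:]" P] by simp

lemma eval2_power [simp]: "eval2 u (P ^ k) = eval2 u P ^ k"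
proof (induction k)
  case 0
  have "eval2 u 1 = 1"
    using eval2_const[of u 1] by (simp add: one_pCons)
  then show ?case by simp
qed simp

section \<open>Formal composition with a polynomial as evaluation\<close>

lemma eval1_eq_sum:
  assumes "degree a < N"
  shows "eval1 v a = (\<Sum>i<N. fps_const (fps_const (coeff a i)) * v ^ i)"
proof -
  let ?p = "map_poly (\<lambda>c. fps_const (fps_const c)) a"
  have "eval1 v a = (\<Sum>i\<le>degree ?p. coeff ?p i * v ^ i)"
    by (simp add: eval1_def poly_altdef)
  also have "\<dots> = (\<Sum>i<N. coeff ?p i * v ^ i)"
    using assms map_poly_degree_leq[of "\<lambda>c. fps_const (fps_const c)" a]
    by (intro sum.mono_neutral_left) (auto simp: coeff_eq_0)
  finally show ?thesis
    by (simp add: coeff_map_poly)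
qed

lemma eval2_eq_sum:
  assumes "degree P < N" and "\<And>j. degree (coeff P j) < N"
  shows "eval2 u P = (\<Sum>j<N. \<Sum>i<N.
    fps_const (fps_const (coeff (coeff P j) i)) * (u $ 1 ^ i * u $ 2 ^ j))"
proof -
  let ?p = "map_poly (eval1 (u $ 1)) P"
  have "eval2 u P = (\<Sum>j\<le>degree ?p. coeff ?p j * u $ 2 ^ j)"
    by (simp add: eval2_def poly_altdef)
  also have "\<dots> = (\<Sum>j<N. coeff ?p j * u $ 2 ^ j)"
    using assms map_poly_degree_leq[of "eval1 (u $ 1)" P]
    by (intro sum.mono_neutral_left) (auto simp: coeff_eq_0)
  finally show ?thesis
    by (simp add: coeff_map_poly eval1_eq_sum[OF assms(2)] sum_distrib_right mult.assoc)
qed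

lemma coeff2_fps2_of_poly: "coeff2 (fps2_of_poly P) m n = coeff (coeff P n) m"
  by (simp add: coeff2_def fps2_of_poly_def coeff_map_poly)

text \<open>Both sides sum the same monomial terms over different finite index sets; the excess
  terms vanish because \<open>u\<close> has zero constant terms.\<close>

lemma fps2_compose_fps2_of_poly:
  assumes u: "zero_const u"
  shows "fps2_compose (fps2_of_poly P) u = eval2 u P"
proof (intro fps_ext)
  fix n m
  \<comment> \<open>\<open>N\<close> exceeds \<open>m + n\<close> and all inner and outer degrees,
    so the square of side \<open>N\<close> contains both the support of \<open>P\<close> and the
    triangle used by \<open>fps2_compose\<close>.\<close>
  define N where "N = Suc (m + n + degree P + (\<Sum>j\<le>degree P. degree (coeff P j)))"
  let ?t = "\<lambda>i j. coeff (coeff P j) i * coeff2 (u $ 1 ^ i * u $ 2 ^ j) m n"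
  have "degree (coeff P j) < N" for j
  proof (cases "j \<le> degree P")
    case True
    then have "degree (coeff P j) \<le> (\<Sum>j\<le>degree P. degree (coeff P j))"
      by (intro member_le_sum) auto
    then show ?thesis by (simp add: N_def)
  qed (simp add: coeff_eq_0 N_def)
  then have "fps_nth (fps_nth (eval2 u P) n) m = (\<Sum>j<N. \<Sum>i<N. ?t i j)"
    by (subst eval2_eq_sum[of P N]) (simp_all add: N_def fps_sum_nth coeff2_def)
  also have "\<dots> = (\<Sum>i<N. \<Sum>j<N. ?t i j)"
    by (rule sum.swap)
  also have "\<dots> = (\<Sum>(i, j)\<in>{..<N} \<times> {..<N}. ?t i j)"
    by (simp add: sum.cartesian_product)
  also have "\<dots> = (\<Sum>(i, j) | i + j \<le> m + n. ?t i j)"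
    by (intro sum.mono_neutral_right)
      (auto simp: N_def simp flip: not_less intro: coeff2_monomial_eq_0[OF u])
  finally show "fps_nth (fps_nth (fps2_compose (fps2_of_poly P) u) n) m =
      fps_nth (fps_nth (eval2 u P) n) m"
    by (simp add: fps2_compose_def coeff2_fps2_of_poly)
qed

lemma fps2_vars_nth [simp]: "fps2_vars $ 1 = fps_const fps_X" "fps2_vars $ 2 = fps_X"
  by (simp_all add: fps2_vars_def)

lemma eval2_fps2_vars: "eval2 fps2_vars P = fps2_of_poly P"
proof -
  have eval1: "eval1 (fps_const fps_X) a = fps_const (fps_of_poly a)" for a
    by (induction a) (simp_all add: eval1_pCons fps_of_poly_pCons mult.commute)
  show ?thesis
  proof (induction P)
    case (pCons a P)
    then show ?case
      by (simp add: eval2_pCons eval1 fps2_of_poly_def fps_of_poly_pCons map_poly_pCons mult.commute)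
  qed (simp add: fps2_of_poly_def)
qed

text \<open>As an outer polynomial over the domain C[x_1], \<open>P - Q\<close> has every constant
  \<open>[:b:]\<close> as a root, which is infinitely many.\<close>

lemma poly2_inject:
  assumes "poly2 P = poly2 Q"
  shows "P = Q"
proof -
  have "poly (poly (P - Q) [:b:]) a = 0" for a b
    using fun_cong[OF assms, of "vector [a, b]"] by (simp add: poly2_def)
  then have "range (\<lambda>b. [:b:]) \<subseteq> {b. poly (P - Q) b = 0}"
    using poly_all_0_iff_0 by blast
  moreover have "infinite (range (\<lambda>b::complex. [:b:]))"
    by (simp add: finite_image_iff inj_on_def infinite_UNIV_char_0)
  ultimately have "infinite {b. poly (P - Q) b = 0}"
    using finite_subset by blast
  then have "P - Q = 0"
    using poly_roots_finite by blast
  then show ?thesis by simp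
qed

text \<open>Identifies the tuple bound existentially in \<open>formal_inverse\<close> with a given
  one.\<close>

lemma poly_map_inject:
  assumes "poly_map p = poly_map q"
  shows "p = q"
proof -
  have "p $ i = q $ i" for i
    using fun_cong[OF assms] by (intro poly2_inject) (auto simp: poly_map_def vec_eq_iff)
  then show ?thesis by (simp add: vec_eq_iff)
qed

text \<open>The hypothesis says that over \<open>\<complex>[[x\<^sub>1]][[x\<^sub>2]]\<close> the equations \<open>p(u) = v\<close> are solved exactly by
  \<open>u = q(v)\<close>; taking \<open>v = x\<close>, respectively \<open>u = x\<close>, yields the two composition identities without
  appealing to associativity of composition.\<close>

lemma formal_inverse_polynomial:
  assumes pq: "\<And>u v. (\<forall>i. eval2 u (p $ i) = v $ i) \<longleftrightarrow> (\<forall>i. eval2 v (q $ i) = u $ i)"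
    and p0: "\<And>i. coeff (coeff (p $ i) 0) 0 = 0"
    and q0: "\<And>i. coeff (coeff (q $ i) 0) 0 = 0"
  shows "formal_inverse (poly_map p) g \<longleftrightarrow> g = (\<chi> i. fps2_of_poly (q $ i))"
proof
  assume "formal_inverse (poly_map p) g"
  then have "zero_const g" "fps2_compose_map (\<chi> i. fps2_of_poly (p $ i)) g = fps2_vars"
    unfolding formal_inverse_def using poly_map_inject by blast+
  then have "\<forall>i. eval2 g (p $ i) = fps2_vars $ i"
    by (simp add: fps2_compose_map_def vec_eq_iff fps2_compose_fps2_of_poly)
  then show "g = (\<chi> i. fps2_of_poly (q $ i))"
    unfolding pq eval2_fps2_vars by (simp add: vec_eq_iff)
next
  assume g: "g = (\<chi> i. fps2_of_poly (q $ i))"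
  let ?F = "\<chi> i. fps2_of_poly (p $ i)"
  have z: "zero_const ?F" "zero_const g"
    by (simp_all add: zero_const_def g coeff2_fps2_of_poly p0 q0)
  have "fps2_compose_map ?F g = fps2_vars"
    using pq[of g fps2_vars] z(2)
    by (simp add: fps2_compose_map_def vec_eq_iff fps2_compose_fps2_of_poly eval2_fps2_vars g)
  moreover have "fps2_compose_map g ?F = fps2_vars"
    using pq[of fps2_vars ?F] z
    by (simp add: fps2_compose_map_def vec_eq_iff fps2_compose_fps2_of_poly eval2_fps2_vars g)
  ultimately show "formal_inverse (poly_map p) g"
    unfolding formal_inverse_def using z by blast
qed

corollary formal_inverse_unique_polynomial:
  assumes "\<And>u v. (\<forall>i. eval2 u (p $ i) = v $ i) \<longleftrightarrow> (\<forall>i. eval2 v (q $ i) = u $ i)"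
    and "\<And>i. coeff (coeff (p $ i) 0) 0 = 0" "\<And>i. coeff (coeff (q $ i) 0) 0 = 0"
  shows "(\<exists>!g. formal_inverse (poly_map p) g) \<and>
    (\<forall>g. formal_inverse (poly_map p) g \<longrightarrow> is_poly_map g)"
  unfolding formal_inverse_polynomial[of p q, OF assms] by (auto simp: is_poly_map_def)

definition pX1 :: "complex poly poly" where "pX1 = [:[:0, 1:]:]"
definition pX2 :: "complex poly poly" where "pX2 = [:0, 1:]"

lemma eval2_pX [simp]: "eval2 u pX1 = u $ 1" "eval2 u pX2 = u $ 2"
  using eval2_const[of u 1]
  by (simp_all add: pX1_def pX2_def eval2_pCons eval1_pCons one_pCons)

lemma poly2_pX [simp]: "poly2 pX1 x = x $ 1" "poly2 pX2 x = x $ 2"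
  by (simp_all add: pX1_def pX2_def poly2_def)

lemma poly2_ops [simp]:
  "poly2 (P + Q) x = poly2 P x + poly2 Q x" "poly2 (P - Q) x = poly2 P x - poly2 Q x"
  "poly2 (P * Q) x = poly2 P x * poly2 Q x" "poly2 (P ^ k) x = poly2 P x ^ k"
  "poly2 (smult [:c:] P) x = c * poly2 P x"
  by (simp_all add: poly2_def)

lemma coeff_0_0_eq_poly2: "coeff (coeff P 0) 0 = poly2 P 0"
  by (simp add: poly2_def poly_0_coeff_0)

subsection \<open>The two normal forms\<close>

text \<open>The right-hand system applies the adjugate of the matrix on the left, which is its
  inverse because the determinant is 1; no division occurs.\<close>

lemma linear_system_solution:
  fixes a b c e :: "'a::idom"
  assumes det: "(1 - a) * (1 - e) - b * c = 1"
  shows "x - (a * x + b * y) = v \<and> y - (c * x + e * y) = w \<longleftrightarrow>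
    (1 - e) * v + b * w = x \<and> c * v + (1 - a) * w = y"
proof (intro iffI conjI; elim conjE)
  assume v: "x - (a * x + b * y) = v" and w: "y - (c * x + e * y) = w"
  have "(1 - e) * v + b * w = ((1 - a) * (1 - e) - b * c) * x"
    "c * v + (1 - a) * w = ((1 - a) * (1 - e) - b * c) * y"
    unfolding v[symmetric] w[symmetric] by (simp_all add: algebra_simps)
  then show "(1 - e) * v + b * w = x" "c * v + (1 - a) * w = y"
    by (simp_all add: det)
next
  assume x: "(1 - e) * v + b * w = x" and y: "c * v + (1 - a) * w = y"
  have "x - (a * x + b * y) = ((1 - a) * (1 - e) - b * c) * v"
    "y - (c * x + e * y) = ((1 - a) * (1 - e) - b * c) * w"
    unfolding x[symmetric] y[symmetric] by (simp_all add: algebra_simps)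
  then show "x - (a * x + b * y) = v" "y - (c * x + e * y) = w"
    by (simp_all add: det)
qed

text \<open>Moving along \<open>(a, b)\<close> leaves the form \<open>p * x + q * y\<close>
  unchanged, so both systems shift by the same power with opposite signs.\<close>

lemma shear_system_solution:
  fixes a b p q :: "'a::comm_ring_1"
  assumes ab: "p * a + q * b = 0"
  shows "x - a * (p * x + q * y) ^ d = v \<and> y - b * (p * x + q * y) ^ d = w \<longleftrightarrow>
    v + a * (p * v + q * w) ^ d = x \<and> w + b * (p * v + q * w) ^ d = y"
proof -
  have "p * (v + a * z) + q * (w + b * z) = p * v + q * w" for v w z
  proof -
    have "p * (v + a * z) + q * (w + b * z) = p * v + q * w + (p * a + q * b) * z"
      by (simp add: algebra_simps)
    then show ?thesis by (simp add: ab)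
  qed
  from this[of v _ w] this[of x "- ((p * x + q * y) ^ d)" y] show ?thesis
    by auto
qed

section \<open>Formal inverses of linear maps and of shears\<close>

lemma linear_map_formal_inverse:
  fixes A :: "complex ^ 2 ^ 2"
  assumes det: "(1 - A $ 1 $ 1) * (1 - A $ 2 $ 2) - A $ 1 $ 2 * A $ 2 $ 1 = 1"
    and f: "\<And>x i. f x $ i = x $ i - (A $ i $ 1 * x $ 1 + A $ i $ 2 * x $ 2)"
  shows "(\<exists>!g. formal_inverse f g) \<and> (\<forall>g. formal_inverse f g \<longrightarrow> is_poly_map g)"
proof -
  define C where "C = (\<lambda>c :: complex. fps_const (fps_const c))"
  have C: "fps_const (fps_const c) = C c" for c
    by (simp add: C_def)
  define L where "L = (\<lambda>i. smult [:A $ i $ 1:] pX1 + smult [:A $ i $ 2:] pX2)"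
  define p q :: "complex poly poly ^ 2" where
    "p = vector [pX1 - L 1, pX2 - L 2]" and
    "q = vector [smult [:1 - A $ 2 $ 2:] pX1 + smult [:A $ 1 $ 2:] pX2,
                 smult [:A $ 2 $ 1:] pX1 + smult [:1 - A $ 1 $ 1:] pX2]"
  have C_diff: "C (1 - c) = 1 - C c" for c
    by (simp add: C_def flip: fps_const_sub)
  \<comment> \<open>The embedding \<open>C\<close> of constants is a ring homomorphism, so the
    determinant condition holds among power series.\<close>
  have det': "(1 - C (A $ 1 $ 1)) * (1 - C (A $ 2 $ 2)) - C (A $ 1 $ 2) * C (A $ 2 $ 1) = 1"
    using arg_cong[OF det, of C] by (simp add: C_def flip: fps_const_sub fps_const_mult)
  have f_eq: "f = poly_map p"
    by (rule ext) (simp add: vec_eq_iff forall_2 f poly_map_def p_def L_def)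
  have pq: "(\<forall>i. eval2 u (p $ i) = v $ i) \<longleftrightarrow> (\<forall>i. eval2 v (q $ i) = u $ i)" for u v
    using linear_system_solution[OF det', of "u $ 1" "u $ 2" "v $ 1" "v $ 2"]
    unfolding forall_2 p_def q_def L_def by (simp add: C C_diff)
  have "coeff (coeff (p $ i) 0) 0 = 0" "coeff (coeff (q $ i) 0) 0 = 0" for i
    using exhaust_2[of i] by (auto simp: coeff_0_0_eq_poly2 p_def q_def L_def)
  then show ?thesis
    unfolding f_eq by (intro formal_inverse_unique_polynomial[of p q] pq)
qed

lemma shear_formal_inverse:
  fixes l w :: "complex ^ 2"
  assumes d: "d \<ge> 1" and lw: "l $ 1 * w $ 1 + l $ 2 * w $ 2 = 0"
    and f: "\<And>x i. f x $ i = x $ i - w $ i * (l $ 1 * x $ 1 + l $ 2 * x $ 2) ^ d"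
  shows "(\<exists>!g. formal_inverse f g) \<and> (\<forall>g. formal_inverse f g \<longrightarrow> is_poly_map g)"
proof -
  define C where "C = (\<lambda>c :: complex. fps_const (fps_const c))"
  have C: "fps_const (fps_const c) = C c" for c
    by (simp add: C_def)
  define L where "L = smult [:l $ 1:] pX1 + smult [:l $ 2:] pX2"
  define p q :: "complex poly poly ^ 2" where
    "p = vector [pX1 - smult [:w $ 1:] (L ^ d), pX2 - smult [:w $ 2:] (L ^ d)]" and
    "q = vector [pX1 + smult [:w $ 1:] (L ^ d), pX2 + smult [:w $ 2:] (L ^ d)]"
  have lw': "C (l $ 1) * C (w $ 1) + C (l $ 2) * C (w $ 2) = 0"
    using arg_cong[OF lw, of C] by (simp add: C_def flip: fps_const_add fps_const_mult)
  have f_eq: "f = poly_map p"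
    by (rule ext) (simp add: vec_eq_iff forall_2 f poly_map_def p_def L_def)
  have pq: "(\<forall>i. eval2 u (p $ i) = v $ i) \<longleftrightarrow> (\<forall>i. eval2 v (q $ i) = u $ i)" for u v
    using shear_system_solution[OF lw', of "u $ 1" "u $ 2" d "v $ 1" "v $ 2"]
    unfolding forall_2 p_def q_def L_def by (simp add: C)
  \<comment> \<open>Since \<open>d\<close> is positive, \<open>L ^ d\<close> vanishes at the
    origin.\<close>
  have "coeff (coeff (p $ i) 0) 0 = 0" "coeff (coeff (q $ i) 0) 0 = 0" for i
    using exhaust_2[of i] d by (auto simp: coeff_0_0_eq_poly2 p_def q_def L_def)
  then show ?thesis
    unfolding f_eq by (intro formal_inverse_unique_polynomial[of p q] pq)
qed

subsection \<open>The Jacobian condition\<close>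

text \<open>The 2 by 2 determinant is expanded and sorted by homogeneous degree in \<open>x\<close>:
  0, \<open>d - 1\<close> and \<open>2 * (d - 1)\<close>.\<close>

lemma Jac_d_linear:
  fixes A :: "complex ^ 2 ^ 2"
  assumes f: "\<And>x i. f x $ i = x $ i - (A $ i $ 1 * x $ 1 + A $ i $ 2 * x $ 2) ^ d"
  shows "Jac f x = (let l = \<lambda>i. (A $ i $ 1 * x $ 1 + A $ i $ 2 * x $ 2) ^ (d - 1) in
    1 - of_nat d * (A $ 1 $ 1 * l 1 + A $ 2 $ 2 * l 2) +
    of_nat d ^ 2 * (l 1 * l 2 * (A $ 1 $ 1 * A $ 2 $ 2 - A $ 1 $ 2 * A $ 2 $ 1)))"
proof -
  define l where "l = (\<lambda>i. (A $ i $ 1 * x $ 1 + A $ i $ 2 * x $ 2) ^ (d - 1))"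
  have "partial_deriv (\<lambda>y. f y $ i) j x = (if i = j then 1 else 0) - of_nat d * A $ i $ j * l i"
    for i j
    unfolding partial_deriv_def f
    using exhaust_2[of i] exhaust_2[of j]
    by (intro DERIV_imp_deriv) (auto simp: l_def intro!: derivative_eq_intros)
  then show ?thesis
    unfolding Jac_def Let_def l_def[symmetric]
    by (simp add: det_2) (simp add: algebra_simps power2_eq_square)
qed

text \<open>If the first row is nonzero, the second is a multiple of it, with the factor read off at
  a nonzero entry; otherwise \<open>l\<close> is the second row.\<close>

lemma rank_one_2x2:
  fixes A :: "'a::field ^ 2 ^ 2"
  assumes "A $ 1 $ 1 * A $ 2 $ 2 = A $ 1 $ 2 * A $ 2 $ 1"
  obtains c l :: "'a ^ 2" where "\<And>i j. A $ i $ j = c $ i * l $ j"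
proof (cases "A $ 1 = 0")
  case True
  then have "A $ i $ j = (vector [0, 1] :: 'a ^ 2) $ i * A $ 2 $ j" for i j
    using exhaust_2[of i] by auto
  then show thesis by (rule that)
next
  case False
  then consider "A $ 1 $ 1 \<noteq> 0" | "A $ 1 $ 2 \<noteq> 0"
    by (auto simp: vec_eq_iff forall_2)
  then show thesis
  proof cases
    case 1
    have "A $ i $ j = (vector [1, A $ 2 $ 1 / A $ 1 $ 1] :: 'a ^ 2) $ i * A $ 1 $ j" for i j
      using exhaust_2[of i] exhaust_2[of j] 1 assms by (auto simp: field_simps)
    then show thesis by (rule that)
  next
    case 2
    have "A $ i $ j = (vector [1, A $ 2 $ 2 / A $ 1 $ 2] :: 'a ^ 2) $ i * A $ 1 $ j" for i j
      using exhaust_2[of i] exhaust_2[of j] 2 assms by (auto simp: field_simps)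
    then show thesis by (rule that)
  qed
qed

theorem theorem2:
  fixes d :: nat and f :: "complex ^ 2 \<Rightarrow> complex ^ 2"
  assumes "d \<ge> 1"
    and "d_linear_map d f"
    and "\<forall>x. Jac f x = 1"
  shows "(\<exists>!g. formal_inverse f g) \<and> (\<forall>g. formal_inverse f g \<longrightarrow> is_poly_map g)"
proof -
  from assms(2) obtain t :: complex and a :: "complex ^ 2 ^ 2" where
    ta: "\<And>x i. f x $ i = x $ i - (t * (a $ i $ 1 * x $ 1 + a $ i $ 2 * x $ 2)) ^ d"
    unfolding d_linear_map_def by blast
  define A :: "complex ^ 2 ^ 2" where "A = (\<chi> i j. t * a $ i $ j)"
  have f: "f x $ i = x $ i - (A $ i $ 1 * x $ 1 + A $ i $ 2 * x $ 2) ^ d" for x i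
    by (simp add: ta A_def algebra_simps)
  define L where "L = (\<lambda>(x :: complex ^ 2) i. A $ i $ 1 * x $ 1 + A $ i $ 2 * x $ 2)"
  define D where "D = A $ 1 $ 1 * A $ 2 $ 2 - A $ 1 $ 2 * A $ 2 $ 1"
  \<comment> \<open>The Jacobian is \<open>1 - \<alpha> x + \<beta> x\<close>, so the hypothesis
    says that the two functions agree.\<close>
  define \<alpha> where "\<alpha> = (\<lambda>x. of_nat d * (A $ 1 $ 1 * L x 1 ^ (d - 1) + A $ 2 $ 2 * L x 2 ^ (d - 1)))"
  define \<beta> where "\<beta> = (\<lambda>x. of_nat d ^ 2 * (L x 1 ^ (d - 1) * L x 2 ^ (d - 1) * D))"
  have jac: "\<alpha> x = \<beta> x" for x
    using assms(3)[rule_format, of x]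
    unfolding Jac_d_linear[of f A d, OF f] Let_def \<alpha>_def \<beta>_def L_def D_def
    by (simp add: algebra_simps)
  show ?thesis
  proof (cases "d = 1")
    case True
    \<comment> \<open>With exponent \<open>d - 1 = 0\<close> all powers are 1, even at the origin.
      Trace equal to determinant means det(I - A) = 1.\<close>
    then have "A $ 1 $ 1 + A $ 2 $ 2 = D"
      using jac[of 0] by (simp add: \<alpha>_def \<beta>_def)
    then show ?thesis
      using f True by (intro linear_map_formal_inverse[of A]) (auto simp: D_def algebra_simps)
  next
    case False
    with assms(1) have d: "d \<ge> 2" by simp
    text \<open>\<open>\<alpha>\<close> and \<open>\<beta>\<close> are homogeneous of the different degrees \<open>d - 1\<close> and \<open>2 (d - 1)\<close>, so
      comparing \<open>x\<close> with \<open>2 x\<close> makes both vanish.\<close>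
    have \<beta>0: "\<beta> x = 0" for x
    proof -
      define k :: complex where "k = 2 ^ (d - 1)"
      have "L (2 *s x) i = 2 * L x i" for i
        by (simp add: L_def algebra_simps)
      then have "\<alpha> (2 *s x) = k * \<alpha> x" "\<beta> (2 *s x) = k * k * \<beta> x"
        unfolding \<alpha>_def \<beta>_def by (simp_all add: power_mult_distrib k_def algebra_simps)
      then have "k * \<beta> x = k * k * \<beta> x"
        using jac[of x] jac[of "2 *s x"] by simp
      then have "k * (k - 1) * \<beta> x = 0"
        by (simp add: algebra_simps)
      \<comment> \<open>This is where \<open>d \<ge> 2\<close> enters: the two degrees
        differ.\<close>
      moreover have "k \<noteq> 0" "k \<noteq> 1"
      proof -
        have "norm k > 1"
          using d by (simp add: k_def norm_power one_less_power)
        then show "k \<noteq> 0" "k \<noteq> 1" by auto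
      qed
      ultimately show ?thesis by simp
    qed
    have "D = 0"
    proof (rule ccontr)
      assume "D \<noteq> 0"
      \<comment> \<open>Cramer's rule for \<open>L x 1 = L x 2 = 1\<close>, a point where
        \<open>\<beta>\<close> would be nonzero.\<close>
      define x :: "complex ^ 2" where
        "x = vector [(A $ 2 $ 2 - A $ 1 $ 2) / D, (A $ 1 $ 1 - A $ 2 $ 1) / D]"
      have "D * L x 1 = D" "D * L x 2 = D"
        using \<open>D \<noteq> 0\<close> by (simp_all add: L_def x_def field_simps) (simp_all add: D_def algebra_simps)
      then have "\<beta> x = of_nat d ^ 2 * D"
        using \<open>D \<noteq> 0\<close> by (simp add: \<beta>_def)
      then show False
        using \<beta>0[of x] d \<open>D \<noteq> 0\<close> by simp
    qed
    then obtain c l :: "complex ^ 2" where cl: "\<And>i j. A $ i $ j = c $ i * l $ j"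
      by (rule_tac rank_one_2x2[of A]) (auto simp: D_def)
    have L: "L x i = c $ i * (l $ 1 * x $ 1 + l $ 2 * x $ 2)" for x i
      by (simp add: L_def cl algebra_simps)
    \<comment> \<open>The \<open>d\<close>-th power of \<open>c $ i\<close> times the common form
      pulls out the factor \<open>c $ i ^ d\<close>.\<close>
    define w :: "complex ^ 2" where "w = (\<chi> i. c $ i ^ d)"
    have cd: "z * z ^ (d - Suc 0) = z ^ d" for z :: complex
      using assms(1) by (simp flip: power_Suc)
    have "l $ 1 * w $ 1 + l $ 2 * w $ 2 = 0"
    proof (cases "l = 0")
      case False
      \<comment> \<open>A point where the common form equals 1; there \<open>\<alpha>\<close> is
        \<open>d\<close> times the sum to be shown zero, since \<open>A $ i $ i\<close> supplies the
        missing factor \<open>c $ i\<close>.\<close>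
      define x :: "complex ^ 2" where
        "x = (if l $ 1 \<noteq> 0 then vector [1 / l $ 1, 0] else vector [0, 1 / l $ 2])"
      have "l $ 1 * x $ 1 + l $ 2 * x $ 2 = 1"
        using False by (auto simp: x_def vec_eq_iff forall_2)
      then have "\<alpha> x = of_nat d * (l $ 1 * (c $ 1 * c $ 1 ^ (d - 1)) + l $ 2 * (c $ 2 * c $ 2 ^ (d - 1)))"
        by (simp add: \<alpha>_def L cl mult_ac)
      then show ?thesis
        using jac[of x] \<beta>0[of x] d by (simp add: cd w_def)
    qed simp
    moreover have "f x $ i = x $ i - w $ i * (l $ 1 * x $ 1 + l $ 2 * x $ 2) ^ d" for x i
      using f[of x i] L[of x i] by (simp add: L_def w_def power_mult_distrib)
    ultimately show ?thesis
      using assms(1) by (intro shear_formal_inverse[of d l w])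
  qed
qed

end
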